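(* The asymptotic growth constant for the number of dimer-monomers on the generalized two-dimensional Sierpinski gasket $SG_{2,3}(n)$, $$z_{SG_{2,3}}=\lim_{n\to\infty}\frac{\ln N_{DM}(SG_{2,3}(n))}{v(SG_{2,3}(n))},$$ is $z_{SG_{2,3}}=0.671617161058\ldots$ (i.e. its decimal expansion begins with the digits shown).
   Context: A dimer-monomer configuration on a finite graph $G$ is a placement of dimers on edges such that each vertex is covered by at most one dimer (i.e. a matching of $G$, not necessarily perfect, possibly empty). $N_{DM}(G)$ is the number of such configurations, and $v(G)$ is the number of vertices of $G$. For an integer $b\ge 2$ the generalized two-dimensional Sierpinski gasket graph $SG_{2,b}(n)$, with three distinguished "outmost" vertices labelled $1,2,3$, is defined recursively. $SG_{2,b}(0)$ is a triangle (three vertices, three edges), all of whose vertices are outmost. $SG_{2,b}(n+1)$ consists of $b$ layers of copies of $SG_{2,b}(n)$ arranged in a triangle of side $b$: take one disjoint copy $C_p$ of $SG_{2,b}(n)$ for each $p\in\mathbb{Z}_{\ge 0}^3$ with coordinate sum $b-1$ (so $b(b+1)/2$ copies), assign to the outmost vertex $l$ of $C_p$ the position $p+e_l$ ($e_1,e_2,e_3$ the standard basis vectors), and identify all outmost vertices of copies having the same position. The outmost vertex $l$ of $SG_{2,b}(n+1)$ is the vertex at position $b\,e_l$. For $b=3$ one has $v(SG_{2,3}(n))=(7\cdot 6^n+8)/5$. *)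

theory Defs
  imports "HOL-Analysis.Analysis"
begin

type_synonym position = "nat \<times> nat \<times> nat"

text \<open>\<open>axis_pos k l\<close> is \<open>k\<close> times the standard basis vector \<open>e\<^sub>l\<close>, for \<open>l \<in> {1, 2, 3}\<close>;
  addition of positions is componentwise.\<close>

definition axis_pos :: "nat \<Rightarrow> nat \<Rightarrow> position" where
  "axis_pos k l = (if l = 1 then k else 0, if l = 2 then k else 0, if l = 3 then k else 0)"

text \<open>Vertices of the recursively glued graphs.  In the graph of level \<open>n + 1\<close>, \<open>Glued q\<close> is the
  class of all outmost vertices of copies having position \<open>q\<close>, and \<open>Inner p x\<close> is the vertex \<open>x\<close>
  of the copy \<open>C\<^sub>p\<close> when \<open>x\<close> is not outmost in that copy (such a vertex is identified with no other).
  At level 0 the vertices of the triangle are named \<open>Glued e\<^sub>l\<close>.\<close>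

datatype vertex = Glued position | Inner position vertex

text \<open>The outmost vertex with label \<open>l\<close>.\<close>

fun outmost :: "nat \<Rightarrow> nat \<Rightarrow> nat \<Rightarrow> vertex" where
  "outmost b 0 l = Glued (axis_pos 1 l)"
| "outmost b (Suc n) l = Glued (axis_pos b l)"

definition copies :: "nat \<Rightarrow> position set" where
  "copies b = {(i, j, k). i + j + k = b - 1}"

text \<open>The canonical map from the copy \<open>C\<^sub>p\<close> of the graph of level \<open>n\<close> to the graph of
  level \<open>n + 1\<close>, i.e. the quotient map restricted to that copy.\<close>

definition glue :: "nat \<Rightarrow> nat \<Rightarrow> position \<Rightarrow> vertex \<Rightarrow> vertex" where
  "glue b n p x =
     (if \<exists>l\<in>{1, 2, 3}. x = outmost b n l
      then Glued (p + axis_pos 1 (THE l. l \<in> {1, 2, 3} \<and> x = outmost b n l))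
      else Inner p x)"

text \<open>A finite simple graph is given by its vertex set and its set of edges, an edge being the set
  of its two endpoints.\<close>

type_synonym 'v graph = "'v set \<times> 'v set set"

fun SG :: "nat \<Rightarrow> nat \<Rightarrow> vertex graph" where
  "SG b 0 =
     (outmost b 0 ` {1, 2, 3},
      {{outmost b 0 l, outmost b 0 m} | l m. l \<in> {1, 2, 3} \<and> m \<in> {1, 2, 3} \<and> l \<noteq> m})"
| "SG b (Suc n) =
     (\<Union>p\<in>copies b. glue b n p ` fst (SG b n),
      \<Union>p\<in>copies b. (\<lambda>e. glue b n p ` e) ` snd (SG b n))"

definition dimer_monomer :: "'v graph \<Rightarrow> 'v set set \<Rightarrow> bool" where
  "dimer_monomer G M \<longleftrightarrow>
     M \<subseteq> snd G \<and> (\<forall>x\<in>fst G. \<forall>d\<in>M. \<forall>d'\<in>M. x \<in> d \<and> x \<in> d' \<longrightarrow> d = d')"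

definition N_DM :: "'v graph \<Rightarrow> nat" where
  "N_DM G = card {M. dimer_monomer G M}"

definition num_vertices :: "'v graph \<Rightarrow> nat" where
  "num_vertices G = card (fst G)"

end

(* Classify the dimer-monomers of the level-n gasket by which of the three outmost vertices they
   cover.  Gluing six copies expresses the eight counts at level n + 1 as homogeneous polynomials of
   degree 6 in the counts at level n.  The ratios between counts differing in a single outmost vertex
   stay in any interval that contains them at one level, and if all of them equal 1/r exactly,
   the count of dimer-monomers avoiding the outmost vertices goes from f to
   f^6 (1 + 2r)^6 (1 + 3r).  At level 3 the ratios agree to 21 digits, so ln f / 6^n is confined from
   there on to an interval narrow enough to read off the limit. *)

theory Submission
  imports Defs
begin

text \<open>The counts obey a coupled recursion, and only the first few levels can be evaluated
  exactly; positivity makes a rigorous enclosure possible all the same. \<open>gasket_step\<close>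
  has nonnegative coefficients, hence is monotone in nonnegative counts. A bound on the ratios traps
  the counts between two product weights (\<open>geometric\<close>), on which the step factorises,
  so the recursion closes on the single number f: the next value lies between f^6 A and f^6 B. From
  level m on this leaves ln f / 6^n uncertain by (ln B - ln A) / (5 * 6^m) in the limit. Level 3 is
  the right place to start: at level 2 the ratios still spread over about 6 * 10^-7, which would
  leave the growth constant uncertain by about 10^-8. At level 3 this error is far below 10^-12, and
  the counts are still integers of 88 digits.\<close>

section \<open>The gluing map and the overlaps of copies\<close>

lemma axis_pos_eq_iff:
  assumes "k \<ge> 1" "l \<in> {1, 2, 3}" "m \<in> {1, 2, 3}"
  shows "axis_pos k l = axis_pos k m \<longleftrightarrow> l = m"
  using assms by (auto simp: axis_pos_def)

lemma outmost_eq_iff: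
  assumes "b \<ge> 1" "l \<in> {1, 2, 3}" "m \<in> {1, 2, 3}"
  shows "outmost b n l = outmost b n m \<longleftrightarrow> l = m"
  using assms by (cases n) (simp_all add: axis_pos_eq_iff)

lemma glue_outmost:
  assumes "b \<ge> 1" "l \<in> {1, 2, 3}"
  shows "glue b n p (outmost b n l) = Glued (p + axis_pos 1 l)"
proof -
  have "(THE m. m \<in> {1, 2, 3} \<and> outmost b n l = outmost b n m) = l"
  proof (rule the_equality)
    fix m assume "m \<in> {1, 2, 3} \<and> outmost b n l = outmost b n m"
    then show "m = l"
      using outmost_eq_iff[OF assms, of m n] by simp
  qed (use assms(2) in simp)
  then show ?thesis
    using assms(2) unfolding glue_def by (simp only: if_P bexI refl cong: if_cong)
qed

lemma glue_inner:
  assumes "x \<notin> outmost b n ` {1, 2, 3}"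
  shows "glue b n p x = Inner p x"
  using assms unfolding glue_def by auto

lemma glue_cases:
  assumes "b \<ge> 1"
  obtains l where "l \<in> {1, 2, 3}" "x = outmost b n l" "\<And>p. glue b n p x = Glued (p + axis_pos 1 l)"
  | "x \<notin> outmost b n ` {1, 2, 3}" "\<And>p. glue b n p x = Inner p x"
  using glue_outmost[OF assms] glue_inner by (cases "x \<in> outmost b n ` {1, 2, 3}") blast+

lemma inj_glue:
  assumes "b \<ge> 1"
  shows "inj (glue b n p)"
proof (rule injI)
  fix x y assume eq: "glue b n p x = glue b n p y"
  show "x = y"
  proof (cases rule: glue_cases[OF assms, where n = n and x = x])
    case x: (1 l)
    show ?thesis
    proof (cases rule: glue_cases[OF assms, where n = n and x = y])
      case y: (1 m)
      from eq x(3) y(3) have "axis_pos 1 l = axis_pos 1 m"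
        by simp
      then have "l = m"
        using axis_pos_eq_iff[of 1 l m] x(1) y(1) by blast
      then show ?thesis
        using x(2) y(2) by simp
    qed (use eq x(3) in simp)
  next
    case 2
    then show ?thesis
      by (cases rule: glue_cases[OF assms, where n = n and x = y]) (use eq in auto)
  qed
qed

lemma glue_eq_distinct:
  assumes "b \<ge> 1" "p \<noteq> q" "glue b n p x = glue b n q y"
  obtains l m where "l \<in> {1, 2, 3}" "m \<in> {1, 2, 3}" "x = outmost b n l" "y = outmost b n m"
    "p + axis_pos 1 l = q + axis_pos 1 m"
proof (cases rule: glue_cases[OF assms(1), where n = n and x = x])
  case (1 l)
  show ?thesis
    by (cases rule: glue_cases[OF assms(1), where n = n and x = y]) (use that 1 assms in auto)
next
  case 2
  show ?thesis
    by (cases rule: glue_cases[OF assms(1), where n = n and x = y]) (use 2 assms in auto)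
qed

text \<open>\<open>q - p\<close> is a difference of two unit vectors and is nonzero, so its only
  positive entry tells \<open>l\<close>.\<close>

lemma axis_pos_shift:
  assumes "p + axis_pos 1 l = q + axis_pos 1 m" "p + axis_pos 1 l' = q + axis_pos 1 m'"
    and "l \<in> {1, 2, 3}" "l' \<in> {1, 2, 3}" "p \<noteq> q"
  shows "l = l'"
proof -
  obtain i j k i' j' k' where [simp]: "p = (i, j, k)" "q = (i', j', k')"
    by (metis prod_cases3)
  show ?thesis
    using assms(3,4)
    by (elim insertE emptyE)
      (use assms(1,2,5) in \<open>simp_all add: axis_pos_def split: if_splits\<close>)
qed

text \<open>Distinct copies share at most one vertex whereas an edge has two, so each glued edge
  comes from a single copy. This makes the decomposition of a dimer-monomer into pieces
  unique.\<close>

lemma glue_overlap: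
  assumes "b \<ge> 1" "p \<noteq> q" "glue b n p x = glue b n q y" "glue b n p x' = glue b n q y'"
  shows "x = x'"
proof -
  obtain l m where lm: "l \<in> {1, 2, 3}" "m \<in> {1, 2, 3}" "x = outmost b n l"
    "p + axis_pos 1 l = q + axis_pos 1 m"
    using glue_eq_distinct[OF assms(1-3)] by metis
  obtain l' m' where lm': "l' \<in> {1, 2, 3}" "m' \<in> {1, 2, 3}" "x' = outmost b n l'"
    "p + axis_pos 1 l' = q + axis_pos 1 m'"
    using glue_eq_distinct[OF assms(1,2,4)] by metis
  show ?thesis
    using axis_pos_shift[OF lm(4) lm'(4)] lm lm' assms(2) by blast
qed

lemma SG_edge:
  assumes "b \<ge> 1" "e \<in> snd (SG b n)"
  obtains x y where "x \<noteq> y" "e = {x, y}" "x \<in> fst (SG b n)" "y \<in> fst (SG b n)"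
proof -
  have "\<exists>x y. x \<noteq> y \<and> e = {x, y} \<and> x \<in> fst (SG b n) \<and> y \<in> fst (SG b n)"
    using assms(2)
  proof (induction n arbitrary: e)
    case 0
    then obtain l m where lm: "l \<in> {1, 2, 3}" "m \<in> {1, 2, 3}" "l \<noteq> m"
      "e = {outmost b 0 l, outmost b 0 m}"
      by auto
    moreover have "outmost b 0 l \<noteq> outmost b 0 m"
      using outmost_eq_iff[OF assms(1)] lm by metis
    moreover have "outmost b 0 l \<in> fst (SG b 0)" "outmost b 0 m \<in> fst (SG b 0)"
      using lm by (auto simp del: outmost.simps)
    ultimately show ?case
      by blast
  next
    case (Suc n)
    then obtain p e' where p: "p \<in> copies b" "e' \<in> snd (SG b n)" "e = glue b n p ` e'"
      by auto
    from Suc.IH[OF p(2)] obtain x y where xy: "x \<noteq> y" "e' = {x, y}"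
      "x \<in> fst (SG b n)" "y \<in> fst (SG b n)"
      by blast
    have "glue b n p x \<noteq> glue b n p y"
      using inj_glue[OF assms(1)] xy(1) by (meson injD)
    moreover have "glue b n p x \<in> fst (SG b (Suc n))" "glue b n p y \<in> fst (SG b (Suc n))"
      using p(1) xy by auto
    ultimately show ?case
      using p(3) xy(2) by blast
  qed
  then show ?thesis
    using that by blast
qed

lemma glue_edge_eq:
  assumes "b \<ge> 1" "e \<in> snd (SG b n)" "e' \<in> snd (SG b n)" "glue b n p ` e = glue b n q ` e'"
  shows "p = q" "e = e'"
proof -
  obtain x y where xy: "x \<noteq> y" "e = {x, y}"
    using SG_edge[OF assms(1,2)] by metis
  have "glue b n p x \<in> glue b n q ` e'" "glue b n p y \<in> glue b n q ` e'"
    using assms(4) xy(2) by blast+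
  then show pq: "p = q"
    using glue_overlap[OF assms(1)] xy(1) by blast
  show "e = e'"
    using assms(4) inj_image_eq_iff[OF inj_glue[OF assms(1)]] unfolding pq by blast
qed

lemma finite_copies: "finite (copies b)"
proof (rule finite_subset)
  show "copies b \<subseteq> {..b} \<times> {..b} \<times> {..b}"
    by (auto simp: copies_def)
qed simp

lemma finite_SG: "finite (fst (SG b n))" "finite (snd (SG b n))"
proof -
  have "finite (fst (SG b n)) \<and> finite (snd (SG b n))"
  proof (induction n)
    case 0
    have "snd (SG b 0) \<subseteq> Pow (fst (SG b 0))"
      by auto
    then show ?case
      by (auto intro: finite_subset)
  qed (simp add: finite_copies)
  then show "finite (fst (SG b n))" "finite (snd (SG b n))"
    by blast+
qed

text \<open>All endpoints of edges are vertices of the graph, so the condition at each vertex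
  becomes disjointness of distinct dimers.\<close>

lemma dimer_monomer_SG_iff:
  assumes "b \<ge> 1"
  shows "dimer_monomer (SG b n) M \<longleftrightarrow>
    M \<subseteq> snd (SG b n) \<and> (\<forall>d\<in>M. \<forall>d'\<in>M. d \<inter> d' \<noteq> {} \<longrightarrow> d = d')"
proof -
  have "x \<in> fst (SG b n)" if "x \<in> e" "e \<in> snd (SG b n)" for x e
    using that(2) by (rule SG_edge[OF assms]) (use that(1) in blast)
  then show ?thesis
    unfolding dimer_monomer_def by blast
qed

section \<open>Cutting dimer-monomers into pieces and reassembling them\<close>

definition assemble :: "nat \<Rightarrow> nat \<Rightarrow> (position \<Rightarrow> vertex set set) \<Rightarrow> vertex set set" where
  "assemble b n \<mu> = (\<Union>p\<in>copies b. (\<lambda>e. glue b n p ` e) ` \<mu> p)"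

definition restriction :: "nat \<Rightarrow> nat \<Rightarrow> vertex set set \<Rightarrow> position \<Rightarrow> vertex set set" where
  "restriction b n M p = {e \<in> snd (SG b n). glue b n p ` e \<in> M}"

text \<open>Conflicts inside one copy are excluded by its own piece; what remains is that among the
  copies meeting at a position at most one covers it.\<close>

definition compatible :: "nat \<Rightarrow> nat \<Rightarrow> (position \<Rightarrow> vertex set set) \<Rightarrow> bool" where
  "compatible b n \<mu> \<longleftrightarrow> (\<forall>p\<in>copies b. \<forall>q\<in>copies b. \<forall>l\<in>{1, 2, 3}. \<forall>m\<in>{1, 2, 3}.
     p \<noteq> q \<longrightarrow> p + axis_pos 1 l = q + axis_pos 1 m \<longrightarrow>
     \<not> (outmost b n l \<in> \<Union>(\<mu> p) \<and> outmost b n m \<in> \<Union>(\<mu> q)))"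

lemma assemble_restriction:
  assumes "M \<subseteq> snd (SG b (Suc n))"
  shows "assemble b n (restriction b n M) = M"
proof
  show "assemble b n (restriction b n M) \<subseteq> M"
    unfolding assemble_def restriction_def by blast
  show "M \<subseteq> assemble b n (restriction b n M)"
  proof
    fix d assume "d \<in> M"
    moreover from this obtain p e where "p \<in> copies b" "e \<in> snd (SG b n)" "d = glue b n p ` e"
      using assms by auto
    ultimately show "d \<in> assemble b n (restriction b n M)"
      unfolding assemble_def restriction_def by blast
  qed
qed

lemma restriction_assemble:
  assumes "b \<ge> 1" "\<And>q. q \<in> copies b \<Longrightarrow> \<mu> q \<subseteq> snd (SG b n)" "p \<in> copies b"
  shows "restriction b n (assemble b n \<mu>) p = \<mu> p"
proof
  show "restriction b n (assemble b n \<mu>) p \<subseteq> \<mu> p"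
  proof
    fix e assume "e \<in> restriction b n (assemble b n \<mu>) p"
    then obtain q e' where *: "e \<in> snd (SG b n)" "q \<in> copies b" "e' \<in> \<mu> q"
      "glue b n p ` e = glue b n q ` e'"
      unfolding restriction_def assemble_def by blast
    moreover have "e' \<in> snd (SG b n)"
      using *(2,3) assms(2) by blast
    ultimately have "p = q" "e = e'"
      using glue_edge_eq[OF assms(1)] by meson+
    then show "e \<in> \<mu> p"
      using *(3) by simp
  qed
  show "\<mu> p \<subseteq> restriction b n (assemble b n \<mu>) p"
    using assms(2,3) unfolding restriction_def assemble_def by blast
qed

lemma dimer_monomer_assemble:
  assumes b: "b \<ge> 1" and \<mu>: "\<And>q. q \<in> copies b \<Longrightarrow> \<mu> q \<subseteq> snd (SG b n)"
  shows "dimer_monomer (SG b (Suc n)) (assemble b n \<mu>) \<longleftrightarrow>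
    (\<forall>p\<in>copies b. dimer_monomer (SG b n) (\<mu> p)) \<and> compatible b n \<mu>"
    (is "?L \<longleftrightarrow> ?R")
proof
  assume ?L
  then have M: "d = d'" if "d \<in> assemble b n \<mu>" "d' \<in> assemble b n \<mu>" "d \<inter> d' \<noteq> {}" for d d'
    using that unfolding dimer_monomer_SG_iff[OF b] by blast
  have same: "p = q \<and> e = e'" if "p \<in> copies b" "q \<in> copies b" "e \<in> \<mu> p" "e' \<in> \<mu> q"
    "x \<in> e" "y \<in> e'" "glue b n p x = glue b n q y" for p q e e' x y
  proof -
    have "glue b n p ` e = glue b n q ` e'"
    proof (rule M)
      show "glue b n p ` e \<inter> glue b n q ` e' \<noteq> {}"
        using that by (metis IntI empty_iff imageI)
    qed (use that in \<open>auto simp: assemble_def\<close>)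
    moreover have "e \<in> snd (SG b n)" "e' \<in> snd (SG b n)"
      using \<mu> that by blast+
    ultimately show ?thesis
      using glue_edge_eq[OF b] by blast
  qed
  have "dimer_monomer (SG b n) (\<mu> p)" if "p \<in> copies b" for p
    using \<mu> same that unfolding dimer_monomer_SG_iff[OF b] by blast
  moreover have "compatible b n \<mu>"
    unfolding compatible_def
  proof (intro ballI impI notI)
    fix p q l m assume "p \<in> copies b" "q \<in> copies b" "l \<in> {1, 2, 3}" "m \<in> {1, 2, 3}"
      "p \<noteq> q" "p + axis_pos 1 l = q + axis_pos 1 m"
      "outmost b n l \<in> \<Union>(\<mu> p) \<and> outmost b n m \<in> \<Union>(\<mu> q)"
    moreover from this have "glue b n p (outmost b n l) = glue b n q (outmost b n m)"
      by (simp only: glue_outmost[OF b])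
    ultimately show False
      using same by blast
  qed
  ultimately show ?R
    by blast
next
  assume R: ?R
  have "d = d'" if d: "d \<in> assemble b n \<mu>" "d' \<in> assemble b n \<mu>" "d \<inter> d' \<noteq> {}" for d d'
  proof -
    from d(1) obtain p e where p: "p \<in> copies b" "e \<in> \<mu> p" "d = glue b n p ` e"
      unfolding assemble_def by blast
    from d(2) obtain q e' where q: "q \<in> copies b" "e' \<in> \<mu> q" "d' = glue b n q ` e'"
      unfolding assemble_def by blast
    from d(3) obtain x y where xy: "x \<in> e" "y \<in> e'" "glue b n p x = glue b n q y"
      unfolding p(3) q(3) by blast
    show ?thesis
    proof (cases "p = q")
      case True
      with xy(3) have "x = y"
        using inj_glue[OF b] by (metis injD)
      then have "e = e'"
        using R p q xy True unfolding dimer_monomer_SG_iff[OF b] by blast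
      then show ?thesis
        using p q True by simp
    next
      case False
      obtain l m where "l \<in> {1, 2, 3}" "m \<in> {1, 2, 3}" "x = outmost b n l" "y = outmost b n m"
        "p + axis_pos 1 l = q + axis_pos 1 m"
        using glue_eq_distinct[OF b False xy(3)] .
      then have False
        using R p q xy False unfolding compatible_def by blast
      then show ?thesis ..
    qed
  qed
  moreover have "assemble b n \<mu> \<subseteq> snd (SG b (Suc n))"
    using \<mu> unfolding assemble_def by fastforce
  ultimately show ?L
    unfolding dimer_monomer_SG_iff[OF b] by blast
qed

lemma axis_pos_in_copies: "l \<in> {1, 2, 3} \<Longrightarrow> axis_pos (b - 1) l \<in> copies b"
  by (auto simp: axis_pos_def copies_def)

text \<open>The corner position is not shared: subtracting a unit vector from \<open>b\<close> times
  the \<open>l\<close>-th one leaves natural entries only for the label \<open>l\<close> itself,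
  which determines the copy.\<close>

lemma outmost_covered_assemble:
  assumes b: "b \<ge> 1" and l: "l \<in> {1, 2, 3}"
  shows "outmost b (Suc n) l \<in> \<Union>(assemble b n \<mu>) \<longleftrightarrow>
    outmost b n l \<in> \<Union>(\<mu> (axis_pos (b - 1) l))"
proof
  have eq: "axis_pos (b - 1) l + axis_pos 1 l = axis_pos b l"
    using b by (auto simp: axis_pos_def)
  {
    assume "outmost b (Suc n) l \<in> \<Union>(assemble b n \<mu>)"
    then obtain p e x where p: "p \<in> copies b" "e \<in> \<mu> p" "x \<in> e" "Glued (axis_pos b l) = glue b n p x"
      unfolding assemble_def by auto
    obtain m where m: "m \<in> {1, 2, 3}" "x = outmost b n m" "axis_pos b l = p + axis_pos 1 m"
      by (cases rule: glue_cases[OF b, where n = n and x = x]) (use p(4) that in auto)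
    from m(3) have "l = m"
      using b l m(1) by (cases p) (auto simp: axis_pos_def)
    with m(3) eq have "p = axis_pos (b - 1) l"
      by (metis add_right_cancel)
    then show "outmost b n l \<in> \<Union>(\<mu> (axis_pos (b - 1) l))"
      using p m \<open>l = m\<close> by blast
  }
  assume "outmost b n l \<in> \<Union>(\<mu> (axis_pos (b - 1) l))"
  then have "glue b n (axis_pos (b - 1) l) (outmost b n l) \<in> \<Union>(assemble b n \<mu>)"
    using axis_pos_in_copies[OF l] unfolding assemble_def by blast
  then show "outmost b (Suc n) l \<in> \<Union>(assemble b n \<mu>)"
    by (simp only: glue_outmost[OF b l] eq outmost.simps)
qed

section \<open>Counting by covered corners for six copies\<close>

definition covered :: "nat \<Rightarrow> nat \<Rightarrow> vertex set set \<Rightarrow> bool" where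
  "covered n l M \<longleftrightarrow> outmost 3 n l \<in> \<Union>M"

definition profile :: "nat \<Rightarrow> vertex set set \<Rightarrow> bool \<times> bool \<times> bool" where
  "profile n M = (covered n 1 M, covered n 2 M, covered n 3 M)"

definition with_profile :: "nat \<Rightarrow> bool \<times> bool \<times> bool \<Rightarrow> vertex set set set" where
  "with_profile n s = {M. dimer_monomer (SG 3 n) M \<and> profile n M = s}"

text \<open>Real-valued, so that the counts can be compared with weights that are not
  integers.\<close>

definition profile_count :: "nat \<Rightarrow> bool \<Rightarrow> bool \<Rightarrow> bool \<Rightarrow> real" where
  "profile_count n s1 s2 s3 = real (card (with_profile n (s1, s2, s3)))"

lemma finite_dimer_monomers: "finite {M. dimer_monomer (SG b n) M}"
  by (rule finite_subset[of _ "Pow (snd (SG b n))"]) (auto simp: dimer_monomer_def finite_SG)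

lemma finite_with_profile: "finite (with_profile n s)"
  by (rule finite_subset[OF _ finite_dimer_monomers[of 3 n]]) (auto simp: with_profile_def)

lemma copies_3: "copies 3 = {(1, 1, 0), (1, 0, 1), (0, 1, 1), (2, 0, 0), (0, 2, 0), (0, 0, 2)}"
proof -
  have "(i, j, k) \<in> copies 3 \<longleftrightarrow>
    (i, j, k) \<in> {(1, 1, 0), (1, 0, 1), (0, 1, 1), (2, 0, 0), (0, 2, 0), (0, 0, 2)}" for i j k
    unfolding copies_def by simp presburger
  then show ?thesis
    by (intro set_eqI) (metis prod_cases3)
qed

type_synonym 'a six = "'a \<times> 'a \<times> 'a \<times> 'a \<times> 'a \<times> 'a"

text \<open>The value \<open>a3\<close> belongs to (0, 0, 2) and is also the default off
  \<open>copies 3\<close>, where values are never consulted.\<close>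

fun spread :: "'a six \<Rightarrow> position \<Rightarrow> 'a" where
  "spread (b12, b13, b23, a1, a2, a3) p =
     (if p = (1, 1, 0) then b12 else if p = (1, 0, 1) then b13 else if p = (0, 1, 1) then b23
      else if p = (2, 0, 0) then a1 else if p = (0, 2, 0) then a2 else a3)"

definition center_free :: "bool \<Rightarrow> bool \<Rightarrow> bool \<Rightarrow> bool" where
  "center_free x y z \<longleftrightarrow> \<not> (x \<and> y) \<and> \<not> (x \<and> z) \<and> \<not> (y \<and> z)"

text \<open>A six-tuple \<open>(b12, b13, b23, a1, a2, a3)\<close> lists the six glued copies: \<open>al\<close> sits at the
  corner \<open>l\<close>, and \<open>blm\<close> between \<open>al\<close> and \<open>am\<close>.  Each triple of states is ordered by corner label.  In
  \<open>blm\<close> the states \<open>ulm\<close>, \<open>vlm\<close> and \<open>klm\<close> belong to the vertex shared with \<open>al\<close>, with \<open>am\<close>, and to the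
  central vertex shared by all three middle copies.\<close>

fun fits :: "(bool \<times> bool \<times> bool) six \<Rightarrow> bool" where
  "fits ((u12, v12, k12), (u13, k13, v13), (k23, u23, v23), (_, x1, y1), (x2, _, y2), (x3, y3, _)) \<longleftrightarrow>
     center_free k12 k13 k23 \<and> \<not> (x1 \<and> u12) \<and> \<not> (y1 \<and> u13) \<and> \<not> (x2 \<and> v12) \<and> \<not> (y2 \<and> u23) \<and>
     \<not> (x3 \<and> v13) \<and> \<not> (y3 \<and> v23)"

fun outer_states :: "(bool \<times> bool \<times> bool) six \<Rightarrow> bool \<times> bool \<times> bool" where
  "outer_states (_, _, _, (s1, _, _), (_, s2, _), (_, _, s3)) = (s1, s2, s3)"

fun map6 :: "('a \<Rightarrow> 'b) \<Rightarrow> 'a six \<Rightarrow> 'b six" where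
  "map6 f (b12, b13, b23, a1, a2, a3) = (f b12, f b13, f b23, f a1, f a2, f a3)"

lemma compatible_spread:
  "compatible 3 n (spread \<tau>) \<longleftrightarrow> fits (map6 (profile n) \<tau>)"
proof -
  obtain b12 b13 b23 a1 a2 a3 where [simp]: "\<tau> = (b12, b13, b23, a1, a2, a3)"
    by (metis prod_cases6)
  have cov: "outmost 3 n l \<in> \<Union>M \<longleftrightarrow> covered n l M" for l M
    by (simp add: covered_def)
  show ?thesis
    unfolding compatible_def copies_3 cov
    by (simp add: axis_pos_def profile_def center_free_def) blast
qed

lemma profile_assemble_spread:
  "profile (Suc n) (assemble 3 n (spread \<tau>)) = outer_states (map6 (profile n) \<tau>)"
proof -
  obtain b12 b13 b23 a1 a2 a3 where [simp]: "\<tau> = (b12, b13, b23, a1, a2, a3)"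
    by (metis prod_cases6)
  have "covered (Suc n) l (assemble 3 n (spread \<tau>)) = covered n l (spread \<tau> (axis_pos 2 l))"
    if "l \<in> {1, 2, 3}" for l
    using outmost_covered_assemble[of 3 l n "spread \<tau>"] that
    by (simp add: covered_def del: spread.simps outmost.simps)
  then show ?thesis
    by (simp add: profile_def axis_pos_def)
qed

definition fitting_tuples :: "nat \<Rightarrow> bool \<times> bool \<times> bool \<Rightarrow> vertex set set six set" where
  "fitting_tuples n s =
     {\<tau>. (\<forall>p\<in>copies 3. dimer_monomer (SG 3 n) (spread \<tau> p)) \<and> fits (map6 (profile n) \<tau>) \<and>
       outer_states (map6 (profile n) \<tau>) = s}"

lemma spread_eq_imp:
  assumes "\<And>p. p \<in> copies 3 \<Longrightarrow> spread \<tau> p = spread \<tau>' p"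
  shows "\<tau> = \<tau>'"
proof -
  obtain b12 b13 b23 a1 a2 a3 where [simp]: "\<tau> = (b12, b13, b23, a1, a2, a3)"
    by (metis prod_cases6)
  obtain b12' b13' b23' a1' a2' a3' where [simp]: "\<tau>' = (b12', b13', b23', a1', a2', a3')"
    by (metis prod_cases6)
  show ?thesis
    using assms[of "(1, 1, 0)"] assms[of "(1, 0, 1)"] assms[of "(0, 1, 1)"]
      assms[of "(2, 0, 0)"] assms[of "(0, 2, 0)"] assms[of "(0, 0, 2)"]
    by (simp add: copies_3)
qed

lemma spread_surj: "\<exists>\<tau>. \<forall>p\<in>copies 3. spread \<tau> p = \<mu> p"
  by (rule exI[of _ "(\<mu> (1, 1, 0), \<mu> (1, 0, 1), \<mu> (0, 1, 1), \<mu> (2, 0, 0), \<mu> (0, 2, 0), \<mu> (0, 0, 2))"])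
    (simp add: copies_3)

text \<open>\<open>restriction\<close> provides the inverse. Six-tuples, unlike functions on
  positions, carry no arbitrary values off the six copies, which is what makes the map
  injective.\<close>

lemma bij_assemble:
  "bij_betw (\<lambda>\<tau>. assemble 3 n (spread \<tau>)) (fitting_tuples n s) (with_profile (Suc n) s)"
proof (rule bij_betw_imageI)
  have dm: "dimer_monomer (SG 3 (Suc n)) (assemble 3 n (spread \<tau>)) \<longleftrightarrow>
    (\<forall>p\<in>copies 3. dimer_monomer (SG 3 n) (spread \<tau> p)) \<and> fits (map6 (profile n) \<tau>)"
    if "\<And>q. q \<in> copies 3 \<Longrightarrow> spread \<tau> q \<subseteq> snd (SG 3 n)" for \<tau>
    using dimer_monomer_assemble[of 3 "spread \<tau>" n] that
    unfolding compatible_spread by simp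
  have sub: "spread \<tau> q \<subseteq> snd (SG 3 n)" if "\<tau> \<in> fitting_tuples n s" "q \<in> copies 3" for \<tau> q
    using that unfolding fitting_tuples_def dimer_monomer_def by blast
  show "inj_on (\<lambda>\<tau>. assemble 3 n (spread \<tau>)) (fitting_tuples n s)"
  proof (rule inj_onI)
    fix \<tau> \<tau>' assume *: "\<tau> \<in> fitting_tuples n s" "\<tau>' \<in> fitting_tuples n s"
      "assemble 3 n (spread \<tau>) = assemble 3 n (spread \<tau>')"
    show "\<tau> = \<tau>'"
    proof (rule spread_eq_imp)
      fix p assume p: "p \<in> copies 3"
      have "spread \<tau> p = restriction 3 n (assemble 3 n (spread \<tau>)) p"
        using restriction_assemble[OF _ sub[OF *(1)] p] by simp
      also have "\<dots> = spread \<tau>' p"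
        using restriction_assemble[OF _ sub[OF *(2)] p] by (simp add: *(3))
      finally show "spread \<tau> p = spread \<tau>' p" .
    qed
  qed
  show "(\<lambda>\<tau>. assemble 3 n (spread \<tau>)) ` fitting_tuples n s = with_profile (Suc n) s"
  proof (intro equalityI subsetI)
    fix M assume "M \<in> (\<lambda>\<tau>. assemble 3 n (spread \<tau>)) ` fitting_tuples n s"
    then obtain \<tau> where \<tau>: "\<tau> \<in> fitting_tuples n s" "M = assemble 3 n (spread \<tau>)"
      by blast
    then have "dimer_monomer (SG 3 (Suc n)) M"
      using dm[OF sub[OF \<tau>(1)]] by (simp add: fitting_tuples_def)
    moreover have "profile (Suc n) M = s"
      using \<tau> by (simp add: profile_assemble_spread fitting_tuples_def)
    ultimately show "M \<in> with_profile (Suc n) s"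
      by (simp add: with_profile_def)
  next
    fix M assume M: "M \<in> with_profile (Suc n) s"
    then have dmM: "dimer_monomer (SG 3 (Suc n)) M"
      by (simp add: with_profile_def)
    obtain \<tau> where \<tau>: "\<forall>p\<in>copies 3. spread \<tau> p = restriction 3 n M p"
      using spread_surj by blast
    have "assemble 3 n (spread \<tau>) = assemble 3 n (restriction 3 n M)"
      using \<tau> unfolding assemble_def by simp
    then have M_eq: "M = assemble 3 n (spread \<tau>)"
      using assemble_restriction[of M 3 n] dmM by (simp add: dimer_monomer_def del: SG.simps)
    have "spread \<tau> q \<subseteq> snd (SG 3 n)" if "q \<in> copies 3" for q
      using that \<tau> unfolding restriction_def by fastforce
    from dm[OF this] have "(\<forall>p\<in>copies 3. dimer_monomer (SG 3 n) (spread \<tau> p)) \<and>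
      fits (map6 (profile n) \<tau>)"
      using dmM M_eq by blast
    moreover have "outer_states (map6 (profile n) \<tau>) = s"
      using M M_eq profile_assemble_spread[of n \<tau>] by (simp add: with_profile_def del: map6.simps)
    ultimately have "\<tau> \<in> fitting_tuples n s"
      by (simp add: fitting_tuples_def)
    then show "M \<in> (\<lambda>\<tau>. assemble 3 n (spread \<tau>)) ` fitting_tuples n s"
      using M_eq by blast
  qed
qed

fun profile_box :: "nat \<Rightarrow> (bool \<times> bool \<times> bool) six \<Rightarrow> vertex set set six set" where
  "profile_box n (b12, b13, b23, a1, a2, a3) = with_profile n b12 \<times> with_profile n b13 \<times>
     with_profile n b23 \<times> with_profile n a1 \<times> with_profile n a2 \<times> with_profile n a3"

lemma mem_profile_box: "\<tau> \<in> profile_box n \<sigma> \<longleftrightarrow>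
  (\<forall>p\<in>copies 3. dimer_monomer (SG 3 n) (spread \<tau> p)) \<and> map6 (profile n) \<tau> = \<sigma>"
proof -
  obtain b12 b13 b23 a1 a2 a3 where [simp]: "\<tau> = (b12, b13, b23, a1, a2, a3)"
    by (metis prod_cases6)
  obtain b12' b13' b23' a1' a2' a3' where [simp]: "\<sigma> = (b12', b13', b23', a1', a2', a3')"
    by (metis prod_cases6)
  show ?thesis
    by (auto simp: copies_3 with_profile_def)
qed

text \<open>Fitting depends on the pieces only through their profiles, so the fitting tuples split
  into disjoint product boxes. Summing over \<open>UNIV\<close> with default 0 allows the sum to be
  nested variable by variable later.\<close>

lemma card_with_profile_Suc:
  "card (with_profile (Suc n) s) =
    (\<Sum>\<sigma>\<in>UNIV. if fits \<sigma> \<and> outer_states \<sigma> = s then card (profile_box n \<sigma>) else 0)"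
proof -
  have "card (with_profile (Suc n) s) = card (fitting_tuples n s)"
    using bij_betw_same_card[OF bij_assemble] by simp
  also have "fitting_tuples n s = (\<Union>\<sigma>\<in>{\<sigma>. fits \<sigma> \<and> outer_states \<sigma> = s}. profile_box n \<sigma>)"
    by (auto simp: fitting_tuples_def mem_profile_box
      simp del: profile_box.simps fits.simps outer_states.simps map6.simps spread.simps)
  also have "card \<dots> = (\<Sum>\<sigma>\<in>{\<sigma>. fits \<sigma> \<and> outer_states \<sigma> = s}. card (profile_box n \<sigma>))"
  proof (rule card_UN_disjoint)
    have "finite (profile_box n \<sigma>)" for \<sigma>
      by (cases \<sigma>) (simp add: finite_with_profile)
    then show "\<forall>\<sigma>\<in>{\<sigma>. fits \<sigma> \<and> outer_states \<sigma> = s}. finite (profile_box n \<sigma>)"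
      by blast
    show "\<forall>\<sigma>\<in>{\<sigma>. fits \<sigma> \<and> outer_states \<sigma> = s}. \<forall>\<sigma>'\<in>{\<sigma>. fits \<sigma> \<and> outer_states \<sigma> = s}.
        \<sigma> \<noteq> \<sigma>' \<longrightarrow> profile_box n \<sigma> \<inter> profile_box n \<sigma>' = {}"
    proof (intro ballI impI equals0I)
      fix \<sigma> \<sigma>' \<tau> assume "\<sigma> \<noteq> \<sigma>'" "\<tau> \<in> profile_box n \<sigma> \<inter> profile_box n \<sigma>'"
      then show False
        unfolding Int_iff mem_profile_box by metis
    qed
  qed (rule finite)
  also have "\<dots> = (\<Sum>\<sigma>\<in>UNIV. if fits \<sigma> \<and> outer_states \<sigma> = s then card (profile_box n \<sigma>) else 0)"
    using sum.inter_filter[OF finite_class.finite_UNIV, of "\<lambda>\<sigma>. card (profile_box n \<sigma>)"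
        "\<lambda>\<sigma>. fits \<sigma> \<and> outer_states \<sigma> = s"]
    by (simp only: UNIV_I simp_thms)
  finally show ?thesis .
qed

section \<open>The polynomial recursion for the counts\<close>

text \<open>Transfer form of the gluing: \<open>corner \<phi> u v\<close> sums out the states of the two inner vertices of a
  corner copy, \<open>u\<close> and \<open>v\<close> telling whether the adjacent middle copies already cover them.\<close>

definition corner :: "(bool \<Rightarrow> bool \<Rightarrow> real) \<Rightarrow> bool \<Rightarrow> bool \<Rightarrow> real" where
  "corner \<phi> u v = (\<Sum>x\<in>UNIV. \<Sum>y\<in>UNIV. of_bool (\<not> (x \<and> u)) * of_bool (\<not> (y \<and> v)) * \<phi> x y)"

text \<open>Corner and middle copies alternate around the centre in a ring of six. With the corners
  summed out, only the nine states of the middle copies are left: 512 terms instead of 8^6.\<close>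

definition six_cycle :: "(bool \<Rightarrow> bool \<Rightarrow> bool \<Rightarrow> real) \<Rightarrow> (bool \<Rightarrow> bool \<Rightarrow> real) \<Rightarrow>
    (bool \<Rightarrow> bool \<Rightarrow> real) \<Rightarrow> (bool \<Rightarrow> bool \<Rightarrow> real) \<Rightarrow> real" where
  "six_cycle w \<phi>1 \<phi>2 \<phi>3 =
    (\<Sum>u12\<in>UNIV. \<Sum>v12\<in>UNIV. \<Sum>k12\<in>UNIV. \<Sum>u13\<in>UNIV. \<Sum>k13\<in>UNIV. \<Sum>v13\<in>UNIV.
     \<Sum>k23\<in>UNIV. \<Sum>u23\<in>UNIV. \<Sum>v23\<in>UNIV. of_bool (center_free k12 k13 k23) *
       (w u12 v12 k12 * w u13 k13 v13 * w k23 u23 v23) *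
       (\<phi>1 u12 u13 * \<phi>2 v12 u23 * \<phi>3 v13 v23))"

definition gasket_step :: "(bool \<Rightarrow> bool \<Rightarrow> bool \<Rightarrow> real) \<Rightarrow> bool \<Rightarrow> bool \<Rightarrow> bool \<Rightarrow> real" where
  "gasket_step w s1 s2 s3 =
     six_cycle w (corner (w s1)) (corner (\<lambda>x y. w x s2 y)) (corner (\<lambda>x y. w x y s3))"

lemma sum_UNIV_prod:
  fixes \<phi> :: "'a::finite \<times> 'b::finite \<Rightarrow> 'c::comm_monoid_add"
  shows "(\<Sum>t\<in>UNIV. \<phi> t) = (\<Sum>x\<in>UNIV. \<Sum>y\<in>UNIV. \<phi> (x, y))"
  using sum.cartesian_product[of "\<lambda>x y. \<phi> (x, y)" UNIV UNIV]
  by (simp only: UNIV_Times_UNIV case_prod_eta)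

lemma sum_mult_three:
  fixes k :: "'a::comm_semiring_0"
  shows "(\<Sum>a\<in>A. \<Sum>b\<in>B. \<Sum>c\<in>C. k * (f a * g b * h c)) = k * (sum f A * sum g B * sum h C)"
  by (simp only: sum_distrib_left[symmetric] sum_distrib_right[symmetric])

lemma profile_count_Suc: "profile_count (Suc n) s1 s2 s3 = gasket_step (profile_count n) s1 s2 s3"
proof -
  let ?w = "\<lambda>(x, y, z). profile_count n x y z"
  let ?c1 = "\<lambda>u v (s, x, y). of_bool (s = s1) * (of_bool (\<not> (x \<and> u)) * of_bool (\<not> (y \<and> v)) * profile_count n s x y)"
  let ?c2 = "\<lambda>u v (x, s, y). of_bool (s = s2) * (of_bool (\<not> (x \<and> u)) * of_bool (\<not> (y \<and> v)) * profile_count n x s y)"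
  let ?c3 = "\<lambda>u v (x, y, s). of_bool (s = s3) * (of_bool (\<not> (x \<and> u)) * of_bool (\<not> (y \<and> v)) * profile_count n x y s)"
  let ?b = "\<lambda>(u12, v12, k12) (u13, k13, v13) (k23, u23, v23).
    of_bool (center_free k12 k13 k23) * (profile_count n u12 v12 k12 * profile_count n u13 k13 v13 * profile_count n k23 u23 v23) *
    ((\<Sum>a1\<in>UNIV. ?c1 u12 u13 a1) * (\<Sum>a2\<in>UNIV. ?c2 v12 u23 a2) * (\<Sum>a3\<in>UNIV. ?c3 v13 v23 a3))"
  have "profile_count (Suc n) s1 s2 s3 = (\<Sum>\<sigma>\<in>UNIV.
      real (if fits \<sigma> \<and> outer_states \<sigma> = (s1, s2, s3) then card (profile_box n \<sigma>) else 0))"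
    by (simp add: profile_count_def card_with_profile_Suc)
  also have "\<dots> = (\<Sum>b12\<in>UNIV. \<Sum>b13\<in>UNIV. \<Sum>b23\<in>UNIV. \<Sum>a1\<in>UNIV. \<Sum>a2\<in>UNIV. \<Sum>a3\<in>UNIV.
      real (if fits (b12, b13, b23, a1, a2, a3) \<and>
        outer_states (b12, b13, b23, a1, a2, a3) = (s1, s2, s3)
        then card (profile_box n (b12, b13, b23, a1, a2, a3)) else 0))"
    by (subst sum_UNIV_prod)+ (rule refl)
  \<comment> \<open>Once the middle copies are fixed, the three corner copies no longer interact and
    their sums factor.\<close>
  also have "\<dots> = (\<Sum>b12\<in>UNIV. \<Sum>b13\<in>UNIV. \<Sum>b23\<in>UNIV. ?b b12 b13 b23)"
  proof (intro sum.cong refl, goal_cases)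
    case (1 b12 b13 b23)
    obtain u12 v12 k12 where [simp]: "b12 = (u12, v12, k12)" by (cases b12)
    obtain u13 k13 v13 where [simp]: "b13 = (u13, k13, v13)" by (cases b13)
    obtain k23 u23 v23 where [simp]: "b23 = (k23, u23, v23)" by (cases b23)
    have "real (if fits (b12, b13, b23, a1, a2, a3) \<and>
        outer_states (b12, b13, b23, a1, a2, a3) = (s1, s2, s3)
        then card (profile_box n (b12, b13, b23, a1, a2, a3)) else 0) =
      of_bool (center_free k12 k13 k23) * (profile_count n u12 v12 k12 * profile_count n u13 k13 v13 * profile_count n k23 u23 v23) *
      (?c1 u12 u13 a1 * ?c2 v12 u23 a2 * ?c3 v13 v23 a3)" for a1 a2 a3
      by (cases a1; cases a2; cases a3) (simp add: card_cartesian_product profile_count_def of_bool_def)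
    then show ?case
      by (simp only: sum_mult_three prod.case \<open>b12 = _\<close> \<open>b13 = _\<close> \<open>b23 = _\<close>)
  qed
  finally have eq: "profile_count (Suc n) s1 s2 s3 = (\<Sum>b12\<in>UNIV. \<Sum>b13\<in>UNIV. \<Sum>b23\<in>UNIV. ?b b12 b13 b23)" .
  have "(\<Sum>a\<in>UNIV. ?c1 u v a) = corner (profile_count n s1) u v" for u v
    by (cases s1) (simp_all add: sum_UNIV_prod corner_def UNIV_bool)
  moreover have "(\<Sum>a\<in>UNIV. ?c2 u v a) = corner (\<lambda>x y. profile_count n x s2 y) u v" for u v
    by (cases s2) (simp_all add: sum_UNIV_prod corner_def UNIV_bool)
  moreover have "(\<Sum>a\<in>UNIV. ?c3 u v a) = corner (\<lambda>x y. profile_count n x y s3) u v" for u v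
    by (cases s3) (simp_all add: sum_UNIV_prod corner_def UNIV_bool)
  ultimately show ?thesis
    unfolding eq gasket_step_def six_cycle_def by (simp only: sum_UNIV_prod prod.case)
qed

section \<open>Persistence of ratio bounds and comparison with product weights\<close>

text \<open>Every outer vertex of the glued graph lies in a single corner copy, so uncovering it changes each
  summand of \<^term>\<open>gasket_step w\<close> by a ratio which already occurs for \<open>w\<close>.  Hence such bounds persist at
  all later levels.\<close>

definition ratio_bounds :: "real \<Rightarrow> real \<Rightarrow> (bool \<Rightarrow> bool \<Rightarrow> bool \<Rightarrow> real) \<Rightarrow> bool" where
  "ratio_bounds a b w \<longleftrightarrow> (\<forall>x y.
     w False x y \<in> {a * w True x y..b * w True x y} \<and>
     w x False y \<in> {a * w x True y..b * w x True y} \<and>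
     w x y False \<in> {a * w x y True..b * w x y True})"

lemma corner_nonneg:
  assumes "\<And>x y. 0 \<le> \<phi> x y"
  shows "0 \<le> corner \<phi> u v"
  unfolding corner_def using assms by (intro sum_nonneg) simp

lemma corner_mono:
  assumes "\<And>x y. \<phi> x y \<le> \<psi> x y"
  shows "corner \<phi> u v \<le> corner \<psi> u v"
  unfolding corner_def using assms by (intro sum_mono mult_left_mono) simp_all

lemma corner_scale: "corner (\<lambda>x y. c * \<phi> x y) u v = c * corner \<phi> u v"
  unfolding corner_def sum_distrib_left by (simp add: mult_ac)

text \<open>A polynomial with nonnegative coefficients is monotone on nonnegative arguments.\<close>

lemma six_cycle_mono:
  assumes "\<And>x y z. 0 \<le> w x y z" "\<And>x y z. w x y z \<le> w' x y z"
    and "\<And>x y. 0 \<le> \<phi>1 x y" "\<And>x y. \<phi>1 x y \<le> \<psi>1 x y"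
    and "\<And>x y. 0 \<le> \<phi>2 x y" "\<And>x y. \<phi>2 x y \<le> \<psi>2 x y"
    and "\<And>x y. 0 \<le> \<phi>3 x y" "\<And>x y. \<phi>3 x y \<le> \<psi>3 x y"
  shows "six_cycle w \<phi>1 \<phi>2 \<phi>3 \<le> six_cycle w' \<psi>1 \<psi>2 \<psi>3"
proof -
  have "0 \<le> w' x y z" "0 \<le> \<psi>1 x y" "0 \<le> \<psi>2 x y" "0 \<le> \<psi>3 x y" for x y z
    using assms by (meson order_trans)+
  then show ?thesis
    unfolding six_cycle_def using assms by (intro sum_mono mult_mono mult_nonneg_nonneg) simp_all
qed

lemma six_cycle_scale:
  "six_cycle w (\<lambda>x y. c * \<phi>1 x y) \<phi>2 \<phi>3 = c * six_cycle w \<phi>1 \<phi>2 \<phi>3"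
  "six_cycle w \<phi>1 (\<lambda>x y. c * \<phi>2 x y) \<phi>3 = c * six_cycle w \<phi>1 \<phi>2 \<phi>3"
  "six_cycle w \<phi>1 \<phi>2 (\<lambda>x y. c * \<phi>3 x y) = c * six_cycle w \<phi>1 \<phi>2 \<phi>3"
  unfolding six_cycle_def sum_distrib_left by (simp_all only: mult_ac)

lemma gasket_step_mono:
  assumes "\<And>x y z. 0 \<le> w x y z" "\<And>x y z. w x y z \<le> w' x y z"
  shows "gasket_step w s1 s2 s3 \<le> gasket_step w' s1 s2 s3"
  unfolding gasket_step_def using assms by (intro six_cycle_mono corner_nonneg corner_mono)

lemma ratio_bounds_step:
  assumes "ratio_bounds a b w" "\<And>x y z. 0 \<le> w x y z" "0 \<le> a" "0 \<le> b"
  shows "ratio_bounds a b (gasket_step w)"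
proof -
  have w: "a * w True x y \<le> w False x y" "w False x y \<le> b * w True x y"
    "a * w x True y \<le> w x False y" "w x False y \<le> b * w x True y"
    "a * w x y True \<le> w x y False" "w x y False \<le> b * w x y True" for x y
    using assms(1) unfolding ratio_bounds_def by auto
  \<comment> \<open>The constant is moved into the weight of the one corner copy concerned;
    monotonicity then compares the two sides.\<close>
  have "a * gasket_step w True x y \<le> gasket_step w False x y" "gasket_step w False x y \<le> b * gasket_step w True x y" for x y
    unfolding gasket_step_def six_cycle_scale(1)[symmetric] corner_scale[symmetric]
    by (intro six_cycle_mono corner_mono corner_nonneg; simp add: w assms)+
  moreover have "a * gasket_step w x True y \<le> gasket_step w x False y" "gasket_step w x False y \<le> b * gasket_step w x True y" for x y
    unfolding gasket_step_def six_cycle_scale(2)[symmetric] corner_scale[symmetric]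
    by (intro six_cycle_mono corner_mono corner_nonneg; simp add: w assms)+
  moreover have "a * gasket_step w x y True \<le> gasket_step w x y False" "gasket_step w x y False \<le> b * gasket_step w x y True" for x y
    unfolding gasket_step_def six_cycle_scale(3)[symmetric] corner_scale[symmetric]
    by (intro six_cycle_mono corner_mono corner_nonneg; simp add: w assms)+
  ultimately show ?thesis
    unfolding ratio_bounds_def by simp
qed

text \<open>A product weight: the three vertices are covered independently, each at relative weight
  \<open>r\<close>.\<close>

definition geometric :: "real \<Rightarrow> real \<Rightarrow> bool \<Rightarrow> bool \<Rightarrow> bool \<Rightarrow> real" where
  "geometric f r x y z = f * (if x then r else 1) * (if y then r else 1) * (if z then r else 1)"

text \<open>Going from \<open>False False False\<close> to \<open>x y z\<close> one coordinate at a
  time, each change to \<open>True\<close> costs a factor between \<open>1 / b\<close> and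
  \<open>1 / a\<close>.\<close>

lemma geometric_bounds:
  assumes "ratio_bounds a b w" "0 < a" "a \<le> b"
  shows "geometric (w False False False) (1 / b) x y z \<le> w x y z"
    and "w x y z \<le> geometric (w False False False) (1 / a) x y z"
proof -
  have *: "w False x y / b \<le> w True x y" "w True x y \<le> w False x y / a"
    "w x False y / b \<le> w x True y" "w x True y \<le> w x False y / a"
    "w x y False / b \<le> w x y True" "w x y True \<le> w x y False / a" for x y
    using assms unfolding ratio_bounds_def by (simp_all add: field_simps)
  have lo: "w False x y * (if s then 1 / b else 1) \<le> w s x y"
    "w x False y * (if s then 1 / b else 1) \<le> w x s y"
    "w x y False * (if s then 1 / b else 1) \<le> w x y s" for s x y
    using *[of x y] by simp_all
  have hi: "w s x y \<le> w False x y * (if s then 1 / a else 1)"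
    "w x s y \<le> w x False y * (if s then 1 / a else 1)"
    "w x y s \<le> w x y False * (if s then 1 / a else 1)" for s x y
    using *[of x y] by simp_all
  have b: "0 \<le> (if s then 1 / b else 1)" and a: "0 \<le> (if s then 1 / a else 1)" for s
    using assms by simp_all
  show "geometric (w False False False) (1 / b) x y z \<le> w x y z"
    unfolding geometric_def
    using lo(1)[of False False x] lo(2)[of x False y] lo(3)[of x y z]
    by (meson b mult_right_mono order_trans)
  show "w x y z \<le> geometric (w False False False) (1 / a) x y z"
    unfolding geometric_def
    using hi(1)[of x False False] hi(2)[of x y False] hi(3)[of x y z]
    by (meson a mult_right_mono order_trans)
qed

lemma corner_geometric:
  "corner (geometric f r False) u v = f * (if u then 1 else 1 + r) * (if v then 1 else 1 + r)"
  "corner (\<lambda>x y. geometric f r x False y) u v = f * (if u then 1 else 1 + r) * (if v then 1 else 1 + r)"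
  "corner (\<lambda>x y. geometric f r x y False) u v = f * (if u then 1 else 1 + r) * (if v then 1 else 1 + r)"
  unfolding corner_def geometric_def by (simp_all add: UNIV_bool algebra_simps)

definition by_size :: "real \<Rightarrow> real \<Rightarrow> real \<Rightarrow> real \<Rightarrow> bool \<Rightarrow> bool \<Rightarrow> bool \<Rightarrow> real" where
  "by_size f g h t x y z =
     (if x then if y then if z then t else h else if z then h else g
      else if y then if z then h else g else if z then g else f)"

text \<open>Independence makes the sum a product over positions: each of the six vertices shared by
  two copies is covered by neither or by one of them (1 + 2r), the centre by none or one of three (1
  + 3r), and the corners are uncovered.\<close>

lemma gasket_step_geometric:
  "gasket_step (geometric f r) False False False = f ^ 6 * ((1 + 2 * r) ^ 6 * (1 + 3 * r))"
proof -
  \<comment> \<open>\<open>r\<close> if the middle copy covers the shared vertex; otherwise the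
    corner copy contributes \<open>1 + r\<close>.\<close>
  have "gasket_step (geometric f r) False False False = f ^ 6 * ((r + (1 + r)) ^ 6 * (1 + 3 * r))"
    unfolding gasket_step_def six_cycle_def corner_geometric
    unfolding geometric_def
    by (simp add: UNIV_bool center_free_def) algebra
  then show ?thesis
    by (simp add: algebra_simps)
qed

section \<open>Exact evaluation of the first three steps\<close>

text \<open>The weights 1, 0, 1, 0 belong to the bare triangle: no dimer, or one dimer covering two
  corners. Symmetry in the three corners is not proved in general; it comes out of these
  evaluations.\<close>

lemma gasket_step_0:
  "gasket_step (by_size 1 0 1 0) =
   by_size 66
     56
     49
     44" (is "?l = ?r")
proof (intro ext)
  fix s1 s2 s3
  show "?l s1 s2 s3 = ?r s1 s2 s3"
    by (cases s1; cases s2; cases s3)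
      (simp_all add: gasket_step_def six_cycle_def corner_def by_size_def UNIV_bool center_free_def)
qed

lemma gasket_step_1:
  "gasket_step (by_size 66 56 49 44) =
   by_size 116464644336176
     100722462529064
     87108127443640
     75334018236644" (is "?l = ?r")
proof (intro ext)
  fix s1 s2 s3
  show "?l s1 s2 s3 = ?r s1 s2 s3"
    by (cases s1; cases s2; cases s3)
      (simp_all add: gasket_step_def six_cycle_def corner_def by_size_def UNIV_bool center_free_def)
qed

lemma gasket_step_2:
  "gasket_step (by_size 116464644336176 100722462529064 87108127443640 75334018236644) =
   by_size 3710736146224534444903373536185820650220252336002311528834519072151585732635018178068480
     3209167432918168031473822528548012517647413415173521317609094567025565102898778511245312
     2775394209308303893102626005652590712922201285976491338068426075051057490890975625871360
     2400252769004864436813832194194316197143144676420267604942169180106032241587723652562944" (is "?l = ?r")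
proof (intro ext)
  fix s1 s2 s3
  show "?l s1 s2 s3 = ?r s1 s2 s3"
    by (cases s1; cases s2; cases s3)
      (simp_all add: gasket_step_def six_cycle_def corner_def by_size_def UNIV_bool center_free_def)
qed

section \<open>From a recursive inequality to the growth rate\<close>

text \<open>The shift c / (d - 1) absorbs the additive constant of x' = d x + c. Shifted by ln A the
  normalised logarithms increase, shifted by ln B they decrease, and the gap tends to 0.\<close>

lemma growth_rate_bounds:
  fixes F :: "nat \<Rightarrow> real" and d :: real
  assumes d: "d > 1" and A: "A > 0" and pos: "\<And>n. n \<ge> m \<Longrightarrow> F n > 0"
    and lower: "\<And>n. n \<ge> m \<Longrightarrow> F n powr d * A \<le> F (Suc n)"
    and upper: "\<And>n. n \<ge> m \<Longrightarrow> F (Suc n) \<le> F n powr d * B"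
  obtains L where "(\<lambda>n. ln (F n) / d ^ n) \<longlonglongrightarrow> L"
    and "(ln (F m) + ln A / (d - 1)) / d ^ m \<le> L"
    and "L \<le> (ln (F m) + ln B / (d - 1)) / d ^ m"
proof -
  define u where "u n = (ln (F (m + n)) + ln A / (d - 1)) / d ^ (m + n)" for n
  define v where "v n = (ln (F (m + n)) + ln B / (d - 1)) / d ^ (m + n)" for n
  have "F m powr d * A \<le> F m powr d * B"
    using lower[of m] upper[of m] by simp
  then have "A \<le> B"
    using pos[of m] by simp
  with A have B: "B > 0" and "ln A \<le> ln B"
    by simp_all
  have ln_Suc: "d * ln (F (m + n)) + ln A \<le> ln (F (Suc (m + n)))"
    "ln (F (Suc (m + n))) \<le> d * ln (F (m + n)) + ln B" for n
  proof -
    have "F (m + n) > 0" "F (Suc (m + n)) > 0"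
      using pos by simp_all
    moreover from this have "ln (F (m + n) powr d * A) \<le> ln (F (Suc (m + n)))"
      "ln (F (Suc (m + n))) \<le> ln (F (m + n) powr d * B)"
      using A B lower[of "m + n"] upper[of "m + n"] by (subst ln_le_cancel_iff; simp)+
    ultimately show "d * ln (F (m + n)) + ln A \<le> ln (F (Suc (m + n)))"
      "ln (F (Suc (m + n))) \<le> d * ln (F (m + n)) + ln B"
      using A B by (simp_all add: ln_mult ln_powr)
  qed
  have c: "d * (x + c / (d - 1)) = d * x + c + c / (d - 1)" for x c
    using d by (simp add: field_simps)
  have scale: "x / d ^ (m + n) = d * x / d ^ (m + Suc n)" for x n
    using d by simp
  have "u n \<le> u (Suc n)" for n
    unfolding u_def scale[of _ n] c using d ln_Suc(1)[of n] by (intro divide_right_mono) simp_all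
  moreover have "v (Suc n) \<le> v n" for n
    unfolding v_def scale[of _ n] c using d ln_Suc(2)[of n] by (intro divide_right_mono) simp_all
  moreover have "u n \<le> v n" for n
    unfolding u_def v_def using d \<open>ln A \<le> ln B\<close>
    by (intro divide_right_mono add_left_mono) simp_all
  moreover have null: "(\<lambda>n. c / d ^ (m + n)) \<longlonglongrightarrow> 0" for c
  proof -
    have "(\<lambda>n. c / d ^ m * inverse (d ^ n)) \<longlonglongrightarrow> c / d ^ m * 0"
      by (intro tendsto_intros LIMSEQ_inverse_realpow_zero d)
    then show ?thesis
      by (simp add: field_simps power_add)
  qed
  moreover have "u n - v n = (ln A / (d - 1) - ln B / (d - 1)) / d ^ (m + n)" for n
    by (simp add: u_def v_def diff_divide_distrib add_divide_distrib)
  ultimately obtain L where L: "\<And>n. u n \<le> L" "u \<longlonglongrightarrow> L" "\<And>n. L \<le> v n"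
    using nested_sequence_unique[of u v] by auto
  show ?thesis
  proof (rule that)
    have "(\<lambda>n. u n - (ln A / (d - 1)) / d ^ (m + n)) \<longlonglongrightarrow> L - 0"
      by (intro tendsto_diff L(2) null)
    then have "(\<lambda>n. ln (F (n + m)) / d ^ (n + m)) \<longlonglongrightarrow> L"
      by (simp add: u_def add_divide_distrib add.commute)
    then show "(\<lambda>n. ln (F n) / d ^ n) \<longlonglongrightarrow> L"
      by (rule LIMSEQ_offset)
  qed (use L(1)[of 0] L(3)[of 0] in \<open>simp_all add: u_def v_def\<close>)
qed

section \<open>Numerical logarithms\<close>

lemma ln_2_bounds: "(0.693147180559945 :: real) \<le> ln 2" "ln 2 \<le> (0.693147180559946 :: real)"
  using ln_approx_bounds[of 2 17] by (simp_all add: lessThan_nat_numeral power_divide)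

text \<open>A window of 10^-12 for the limit is one of 1.512 * 10^-9 for 1512 times it, and the
  lower end has a margin of only about 10^-10. Hence the ten decimals here, and the fifteen for
  \<open>ln 2\<close>, whose error is multiplied by 1465.\<close>

lemma ln_lower: "(0.0245279995 :: real) \<le> ln 1.02483128571"
  and ln_upper: "ln 1.02483128572 \<le> (0.024528 :: real)"
  using ln_approx_bounds[of "1.02483128571" 3] ln_approx_bounds[of "1.02483128572" 3]
  by (simp_all add: lessThan_nat_numeral power_divide)

text \<open>At level 3 the quantity \<open>5 * ln f + ln R\<close> equals \<open>1512 * z\<close> up to the error in \<open>R\<close>, where
  \<open>1512 = 7 * 6^3\<close>, and \<open>f ^ 5 * R\<close> is close to \<open>2 ^ 1465 * 1.0248312857\<close>.  The power \<open>2 ^ 1465\<close> is split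
  so that the numerals compared below stay small, and \<open>32815659850011\<close> is \<open>f / 2 ^ 246\<close> rounded down.\<close>

lemma log_scaled_lower:
  fixes X R w f :: real
  assumes "X > 0" "R > 0" "w > 0" "f > 0"
    and "X * 2 ^ 246 \<le> f" "2 ^ 235 * w \<le> X ^ 5 * R"
  shows "1465 * ln 2 + ln w \<le> 5 * ln f + ln R"
proof -
  have "ln (2 ^ 235 * w) \<le> ln (X ^ 5 * R)"
    using assms by (subst ln_le_cancel_iff) (simp_all del: power_numeral)
  moreover have "ln (X * 2 ^ 246) \<le> ln f"
    using assms by (subst ln_le_cancel_iff) (simp_all del: power_numeral)
  ultimately show ?thesis
    using assms(1-4) by (simp add: ln_mult ln_realpow del: power_numeral)
qed

lemma log_scaled_upper:
  fixes X R w f :: real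
  assumes "X > 0" "R > 0" "w > 0" "f > 0"
    and "f \<le> X * 2 ^ 246" "X ^ 5 * R \<le> 2 ^ 235 * w"
  shows "5 * ln f + ln R \<le> 1465 * ln 2 + ln w"
proof -
  have "ln (X ^ 5 * R) \<le> ln (2 ^ 235 * w)"
    using assms by (subst ln_le_cancel_iff) (simp_all del: power_numeral)
  moreover have "ln f \<le> ln (X * 2 ^ 246)"
    using assms by (subst ln_le_cancel_iff) (simp_all del: power_numeral)
  ultimately show ?thesis
    using assms(1-4) by (simp add: ln_mult ln_realpow del: power_numeral)
qed

lemma log_growth_lower:
  fixes f :: real
  assumes "32815659850011 * 2 ^ 246 \<le> f" "f > 0"
  shows "1465 * ln 2 + ln 1.02483128571 \<le>
    5 * ln f + ln ((1 + 2 * (1 / 1.15629247267110608)) ^ 6 * (1 + 3 * (1 / 1.15629247267110608)))"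
proof -
  \<comment> \<open>1 + k / a = (a + k) / a, with numerator and denominator scaled by 10^17 to
    integers.\<close>
  have R: "(1 + 2 * (1 / 1.15629247267110608)) ^ 6 * (1 + 3 * (1 / 1.15629247267110608)) =
    (315629247267110608 / 115629247267110608) ^ 6 * (415629247267110608 / 115629247267110608 :: real)"
    by simp
  show ?thesis
    unfolding R
  proof (rule log_scaled_lower[OF _ _ _ assms(2,1)])
    show "(2::real) ^ 235 * 1.02483128571 \<le> 32815659850011 ^ 5 * ((315629247267110608 / 115629247267110608) ^ 6 * (415629247267110608 / 115629247267110608 :: real))"
      unfolding power_divide by simp
  qed simp_all
qed

lemma log_growth_upper:
  fixes f :: real
  assumes "f \<le> 32815659850012 * 2 ^ 246" "f > 0"
  shows "5 * ln f + ln ((1 + 2 * (1 / 1.15629247267110607)) ^ 6 * (1 + 3 * (1 / 1.15629247267110607))) \<le> 1465 * ln 2 + ln 1.02483128572"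
proof -
  have R: "(1 + 2 * (1 / 1.15629247267110607)) ^ 6 * (1 + 3 * (1 / 1.15629247267110607)) =
    (315629247267110607 / 115629247267110607) ^ 6 * (415629247267110607 / 115629247267110607 :: real)"
    by simp
  show ?thesis
    unfolding R
  proof (rule log_scaled_upper[OF _ _ _ assms(2,1)])
    show "32815659850012 ^ 5 * ((315629247267110607 / 115629247267110607) ^ 6 * (415629247267110607 / 115629247267110607 :: real)) \<le> (2::real) ^ 235 * 1.02483128572"
      unfolding power_divide by simp
  qed simp_all
qed

section \<open>Counts of the gasket and their bounds from level 3 on\<close>

lemma profile_count_nonneg: "0 \<le> profile_count n x y z"
  by (simp add: profile_count_def)

lemma triangle_edges:
  "snd (SG 3 0) = {{Glued (1, 0, 0), Glued (0, 1, 0)}, {Glued (1, 0, 0), Glued (0, 0, 1)},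
    {Glued (0, 1, 0), Glued (0, 0, 1)}}" (is "_ = ?E")
proof -
  have "snd (SG 3 0) = (\<Union>l\<in>{1, 2, 3}. \<Union>m\<in>{1, 2, 3} - {l}. {{outmost 3 0 l, outmost 3 0 m}})"
    unfolding SG.simps snd_conv by blast
  also have "\<dots> = ?E"
    by (simp add: axis_pos_def insert_commute insert_Diff_if)
  finally show ?thesis .
qed

text \<open>Any two edges of a triangle meet, so there is at most one dimer.\<close>

lemma triangle_dimer_monomers:
  "{M. dimer_monomer (SG 3 0) M} = {{}, {{Glued (1, 0, 0), Glued (0, 1, 0)}},
    {{Glued (1, 0, 0), Glued (0, 0, 1)}}, {{Glued (0, 1, 0), Glued (0, 0, 1)}}}" (is "_ = ?D")
proof -
  have meet: "d \<inter> d' \<noteq> {}" if "d \<in> snd (SG 3 0)" "d' \<in> snd (SG 3 0)" for d d'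
    using that unfolding triangle_edges by auto
  have "dimer_monomer (SG 3 0) M \<longleftrightarrow> M = {} \<or> (\<exists>d\<in>snd (SG 3 0). M = {d})" for M
  proof
    assume dm: "dimer_monomer (SG 3 0) M"
    then have "d = d'" if "d \<in> M" "d' \<in> M" for d d'
      using that meet[of d d'] dimer_monomer_SG_iff[of 3 0 M] by auto
    then have "M = {} \<or> (\<exists>d. M = {d})"
      by blast
    moreover have "M \<subseteq> snd (SG 3 0)"
      using dm by (simp add: dimer_monomer_def)
    ultimately show "M = {} \<or> (\<exists>d\<in>snd (SG 3 0). M = {d})"
      by blast
  next
    assume "M = {} \<or> (\<exists>d\<in>snd (SG 3 0). M = {d})"
    then show "dimer_monomer (SG 3 0) M"
      unfolding dimer_monomer_def by blast
  qed
  then show ?thesis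
    unfolding triangle_edges by blast
qed

lemma profile_count_0: "profile_count 0 = by_size 1 0 1 0"
proof (intro ext)
  fix x y z
  have "with_profile 0 s = {M \<in> {M. dimer_monomer (SG 3 0) M}. profile 0 M = s}" for s
    by (simp add: with_profile_def)
  then have "with_profile 0 s = {M \<in> {{}, {{Glued (1, 0, 0), Glued (0, 1, 0)}},
    {{Glued (1, 0, 0), Glued (0, 0, 1)}}, {{Glued (0, 1, 0), Glued (0, 0, 1)}}}. profile 0 M = s}" for s
    unfolding triangle_dimer_monomers .
  then have "card (with_profile 0 s) = (\<Sum>M\<in>{{}, {{Glued (1, 0, 0), Glued (0, 1, 0)}},
    {{Glued (1, 0, 0), Glued (0, 0, 1)}}, {{Glued (0, 1, 0), Glued (0, 0, 1)}}}. of_bool (profile 0 M = s))" for s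
    by (simp only: card_eq_sum sum.inter_filter[symmetric] of_bool_def finite.intros)
  then show "profile_count 0 x y z = by_size 1 0 1 0 x y z"
    by (cases x; cases y; cases z)
      (simp_all add: profile_count_def by_size_def profile_def covered_def axis_pos_def doubleton_eq_iff)
qed

lemma profile_count_3:
  "profile_count 3 =
   by_size 3710736146224534444903373536185820650220252336002311528834519072151585732635018178068480
     3209167432918168031473822528548012517647413415173521317609094567025565102898778511245312
     2775394209308303893102626005652590712922201285976491338068426075051057490890975625871360
     2400252769004864436813832194194316197143144676420267604942169180106032241587723652562944"
proof -
  have "profile_count (Suc n) = gasket_step (profile_count n)" for n
    by (intro ext) (rule profile_count_Suc)
  then have "profile_count 3 = gasket_step (gasket_step (gasket_step (profile_count 0)))"
    by (simp add: numeral_3_eq_3)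
  then show ?thesis
    by (simp only: profile_count_0 gasket_step_0 gasket_step_1 gasket_step_2)
qed

text \<open>The endpoints are the common ratio at level 3 rounded down and up to 17 decimals; a
  width of 10^-17 moves the logarithm of the growth factor by less than 10^-16.\<close>

lemma profile_count_ratio_bounds:
  assumes "n \<ge> 3"
  shows "ratio_bounds 1.15629247267110607 1.15629247267110608 (profile_count n)"
  using assms
proof (induction n rule: nat_induct_at_least)
  case base
  show ?case
    unfolding profile_count_3 ratio_bounds_def
    by (intro allI) (rename_tac x y, case_tac x; case_tac y; simp add: by_size_def)
next
  case (Suc n)
  have "profile_count (Suc n) = gasket_step (profile_count n)"
    by (intro ext) (rule profile_count_Suc)
  then show ?case
    using ratio_bounds_step[OF Suc.IH profile_count_nonneg] by simp
qed

text \<open>The step is monotone and the counts lie between two product weights. The larger ratio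
  means the smaller \<open>r\<close>, hence the lower bound.\<close>

lemma profile_count_Suc_bounds:
  assumes "n \<ge> 3"
  shows "profile_count n False False False ^ 6 *
      ((1 + 2 * (1 / 1.15629247267110608)) ^ 6 * (1 + 3 * (1 / 1.15629247267110608)))
      \<le> profile_count (Suc n) False False False" (is "_ * ?A \<le> _")
    and "profile_count (Suc n) False False False \<le> profile_count n False False False ^ 6 *
      ((1 + 2 * (1 / 1.15629247267110607)) ^ 6 * (1 + 3 * (1 / 1.15629247267110607)))"
  unfolding profile_count_Suc gasket_step_geometric[symmetric]
  using geometric_bounds[OF profile_count_ratio_bounds[OF assms]] profile_count_nonneg
  by (intro gasket_step_mono; simp add: geometric_def)+

lemma profile_count_False_pos:
  assumes "n \<ge> 3"
  shows "0 < profile_count n False False False"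
  using assms
proof (induction n rule: nat_induct_at_least)
  case base
  show ?case
    by (simp add: profile_count_3 by_size_def)
next
  case (Suc n)
  show ?case
    by (rule less_le_trans[OF _ profile_count_Suc_bounds(1)[OF Suc.hyps]])
      (use Suc.IH in \<open>simp add: zero_less_mult_iff\<close>)
qed

lemma N_DM_eq_sum: "real (N_DM (SG 3 n)) = (\<Sum>x\<in>UNIV. \<Sum>y\<in>UNIV. \<Sum>z\<in>UNIV. profile_count n x y z)"
proof -
  have "{M. dimer_monomer (SG 3 n) M} = (\<Union>s\<in>UNIV. with_profile n s)"
    by (auto simp: with_profile_def)
  then have "N_DM (SG 3 n) = card (\<Union>s\<in>UNIV. with_profile n s)"
    by (simp only: N_DM_def)
  also have "\<dots> = (\<Sum>s\<in>UNIV. card (with_profile n s))"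
    by (rule card_UN_disjoint) (simp, use finite_with_profile in blast, auto simp: with_profile_def)
  finally show ?thesis
    by (simp add: sum_UNIV_prod profile_count_def)
qed

text \<open>All ratios exceed 1, so the corner-avoiding count is the largest of the eight. The
  factor 8 disappears after dividing the logarithm by 6^n.\<close>

lemma N_DM_bounds:
  assumes "n \<ge> 3"
  shows "profile_count n False False False \<le> real (N_DM (SG 3 n))"
    and "real (N_DM (SG 3 n)) \<le> 8 * profile_count n False False False"
proof -
  show "profile_count n False False False \<le> real (N_DM (SG 3 n))"
    using profile_count_nonneg[of n] by (simp add: N_DM_eq_sum UNIV_bool add_nonneg_nonneg)
  have "profile_count n x y z \<le> profile_count n False False False" for x y z
  proof (rule order_trans)
    show "profile_count n x y z \<le> geometric (profile_count n False False False) (1 / 1.15629247267110607) x y z"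
      by (rule geometric_bounds[OF profile_count_ratio_bounds[OF assms]]) simp_all
    show "geometric (profile_count n False False False) (1 / 1.15629247267110607) x y z \<le> profile_count n False False False"
      unfolding geometric_def using profile_count_nonneg[of n False False False]
      by (cases x; cases y; cases z) simp_all
  qed
  then have "(\<Sum>x\<in>UNIV. \<Sum>y\<in>UNIV. \<Sum>z\<in>UNIV. profile_count n x y z) \<le>
    (\<Sum>x\<in>(UNIV::bool set). \<Sum>y\<in>(UNIV::bool set). \<Sum>z\<in>(UNIV::bool set). profile_count n False False False)"
    by (intro sum_mono)
  then show "real (N_DM (SG 3 n)) \<le> 8 * profile_count n False False False"
    by (simp add: N_DM_eq_sum)
qed

section \<open>The number of vertices\<close>

lemma outmost_in_SG:
  assumes "b \<ge> 1" "l \<in> {1, 2, 3}"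
  shows "outmost b n l \<in> fst (SG b n)"
proof (induction n)
  case 0
  show ?case
    using assms(2) by auto
next
  case (Suc n)
  have "axis_pos (b - 1) l + axis_pos 1 l = axis_pos b l"
    using assms(1) by (auto simp: axis_pos_def)
  then have "outmost b (Suc n) l = glue b n (axis_pos (b - 1) l) (outmost b n l)"
    by (simp only: glue_outmost[OF assms] outmost.simps)
  then show ?case
    using Suc axis_pos_in_copies[OF assms(2)] by (simp del: outmost.simps) blast
qed

text \<open>Each copy contributes its vertices except three, and ten glued positions are added: 10 -
  6 * 3 = -8.\<close>

lemma num_vertices_Suc: "num_vertices (SG 3 (Suc n)) + 8 = 6 * num_vertices (SG 3 n)"
proof -
  define V where "V = fst (SG 3 n)"
  define C where "C = outmost 3 n ` {1, 2, 3}"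
  define P where "P = (\<Union>p\<in>copies 3. (\<lambda>l. p + axis_pos 1 l) ` {1, 2, 3})"
  have "finite V" "C \<subseteq> V"
    using finite_SG outmost_in_SG[of 3] by (auto simp: V_def C_def simp del: outmost.simps SG.simps)
  have "inj_on (outmost 3 n) {1, 2, 3}"
    by (rule inj_onI) (use outmost_eq_iff[of 3] in simp)
  then have "card C = 3"
    by (simp add: C_def card_image)
  have glue_C: "glue 3 n p ` C = (\<lambda>l. Glued (p + axis_pos 1 l)) ` {1, 2, 3}" for p
    unfolding C_def image_image by (intro image_cong refl glue_outmost) simp
  have glue_diff: "glue 3 n p ` (V - C) = Inner p ` (V - C)" for p
    unfolding C_def by (intro image_cong refl glue_inner) simp
  have "fst (SG 3 (Suc n)) = (\<Union>p\<in>copies 3. glue 3 n p ` C) \<union> (\<Union>p\<in>copies 3. glue 3 n p ` (V - C))"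
    using \<open>C \<subseteq> V\<close> unfolding SG.simps fst_conv V_def[symmetric] by blast
  also have "(\<Union>p\<in>copies 3. glue 3 n p ` C) = Glued ` P"
    unfolding glue_C P_def by auto
  also have "(\<Union>p\<in>copies 3. glue 3 n p ` (V - C)) = (\<lambda>(p, x). Inner p x) ` (copies 3 \<times> (V - C))"
    unfolding glue_diff by auto
  finally have "num_vertices (SG 3 (Suc n)) =
    card (Glued ` P \<union> (\<lambda>(p, x). Inner p x) ` (copies 3 \<times> (V - C)))"
    by (simp only: num_vertices_def)
  also have "\<dots> = card (Glued ` P) + card ((\<lambda>(p, x). Inner p x) ` (copies 3 \<times> (V - C)))"
    by (rule card_Un_disjoint) (auto simp: P_def finite_copies \<open>finite V\<close>)
  also have "card (Glued ` P) = card P"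
    by (rule card_image) (simp add: inj_on_def)
  \<comment> \<open>The points with coordinate sum 3: three corners, six shared by two copies, and
    the centre.\<close>
  also have "card P = 10"
    unfolding P_def copies_3 by (simp add: axis_pos_def numeral_2_eq_2 numeral_3_eq_3 card_insert_if)
  also have "card ((\<lambda>(p, x). Inner p x) ` (copies 3 \<times> (V - C))) = card (copies 3 \<times> (V - C))"
    by (rule card_image) (auto simp: inj_on_def)
  also have "\<dots> = 6 * (card V - 3)"
    using \<open>finite V\<close> \<open>C \<subseteq> V\<close> \<open>card C = 3\<close>
    by (simp add: card_cartesian_product copies_3 card_Diff_subset finite_subset)
  finally have "num_vertices (SG 3 (Suc n)) = 10 + 6 * (card V - 3)" .
  moreover have "card V \<ge> 3"
    using card_mono[OF \<open>finite V\<close> \<open>C \<subseteq> V\<close>] \<open>card C = 3\<close> by simp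
  ultimately show ?thesis
    by (simp add: V_def num_vertices_def)
qed

lemma num_vertices_SG_3: "real (num_vertices (SG 3 n)) = (7 * 6 ^ n + 8) / 5"
proof (induction n)
  case 0
  have "card (fst (SG 3 0)) = 3"
    by (simp add: axis_pos_def)
  then show ?case
    by (simp add: num_vertices_def)
next
  case (Suc n)
  have "real (num_vertices (SG 3 (Suc n))) = 6 * real (num_vertices (SG 3 n)) - 8"
    using num_vertices_Suc[of n] by linarith
  then show ?case
    using Suc by simp
qed

section \<open>The growth constant\<close>

text \<open>The factor 5/7 arises because the number of vertices is asymptotic to (7/5) 6^n.\<close>

lemma N_DM_growth:
  assumes "(\<lambda>n. ln (profile_count n False False False) / 6 ^ n) \<longlonglongrightarrow> L"
  shows "(\<lambda>n. ln (real (N_DM (SG 3 n))) / real (num_vertices (SG 3 n))) \<longlonglongrightarrow> 5 / 7 * L"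
proof -
  have inv: "(\<lambda>n. inverse ((6::real) ^ n)) \<longlonglongrightarrow> 0"
    by (rule LIMSEQ_inverse_realpow_zero) simp
  have "(\<lambda>n. ln (real (N_DM (SG 3 n))) / 6 ^ n) \<longlonglongrightarrow> L"
  proof (rule tendsto_sandwich)
    show "\<forall>\<^sub>F n in sequentially.
        ln (profile_count n False False False) / 6 ^ n \<le> ln (real (N_DM (SG 3 n))) / 6 ^ n"
      using eventually_ge_at_top[of 3]
    proof eventually_elim
      case (elim n)
      then show ?case
        using N_DM_bounds(1)[of n] profile_count_False_pos[of n] by (intro divide_right_mono) simp_all
    qed
    show "\<forall>\<^sub>F n in sequentially. ln (real (N_DM (SG 3 n))) / 6 ^ n \<le>
        ln 8 * inverse (6 ^ n) + ln (profile_count n False False False) / 6 ^ n"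
      using eventually_ge_at_top[of 3]
    proof eventually_elim
      case (elim n)
      have pos: "0 < profile_count n False False False"
        using profile_count_False_pos elim by simp
      have "ln (real (N_DM (SG 3 n))) \<le> ln (8 * profile_count n False False False)"
        using N_DM_bounds[OF elim] pos by (subst ln_le_cancel_iff) simp_all
      also have "\<dots> = ln 8 + ln (profile_count n False False False)"
        using pos by (simp add: ln_mult)
      finally show ?case
        by (simp add: field_simps)
    qed
    show "(\<lambda>n. ln 8 * inverse (6 ^ n) + ln (profile_count n False False False) / 6 ^ n) \<longlonglongrightarrow> L"
      using tendsto_add[OF tendsto_mult_left[OF inv, of "ln 8"] assms] by simp
  qed (rule assms)
  moreover have "(\<lambda>n. real (num_vertices (SG 3 n)) / 6 ^ n) \<longlonglongrightarrow> 7 / 5"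
  proof -
    have "real (num_vertices (SG 3 n)) / 6 ^ n = 7 / 5 + 8 / 5 * inverse (6 ^ n)" for n
      by (simp add: num_vertices_SG_3 field_simps)
    then show ?thesis
      using tendsto_add[OF tendsto_const[of "7 / 5"] tendsto_mult_left[OF inv, of "8 / 5"]] by simp
  qed
  ultimately have "(\<lambda>n. (ln (real (N_DM (SG 3 n))) / 6 ^ n) / (real (num_vertices (SG 3 n)) / 6 ^ n))
      \<longlonglongrightarrow> L / (7 / 5)"
    by (rule tendsto_divide) simp
  then show ?thesis
    by (simp add: mult.commute)
qed

theorem mainTheorem3:
  shows "\<exists>z :: real.
    (\<lambda>n. ln (real (N_DM (SG 3 n))) / real (num_vertices (SG 3 n))) \<longlonglongrightarrow> z \<and>
    0.671617161058 \<le> z \<and> z < 0.671617161059"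
proof -
  define A :: real where "A = (1 + 2 * (1 / 1.15629247267110608)) ^ 6 * (1 + 3 * (1 / 1.15629247267110608))"
  define B :: real where "B = (1 + 2 * (1 / 1.15629247267110607)) ^ 6 * (1 + 3 * (1 / 1.15629247267110607))"
  define f where "f = profile_count 3 False False False"
  have "A > 0"
    by (simp add: A_def)
  obtain L where L: "(\<lambda>n. ln (profile_count n False False False) / 6 ^ n) \<longlonglongrightarrow> L"
    "(ln f + ln A / (6 - 1)) / 6 ^ 3 \<le> L" "L \<le> (ln f + ln B / (6 - 1)) / 6 ^ 3"
  proof (rule growth_rate_bounds[of 6 A 3 "\<lambda>n. profile_count n False False False" B])
    fix n :: nat assume n: "n \<ge> 3"
    have "profile_count n False False False powr 6 = profile_count n False False False ^ 6"
      using profile_count_False_pos[OF n] by (simp add: powr_numeral)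
    then show "profile_count n False False False powr 6 * A \<le> profile_count (Suc n) False False False"
      "profile_count (Suc n) False False False \<le> profile_count n False False False powr 6 * B"
      using profile_count_Suc_bounds[OF n] unfolding A_def B_def by simp_all
  qed (use \<open>A > 0\<close> profile_count_False_pos that in \<open>auto simp: f_def\<close>)
  have f: "32815659850011 * 2 ^ 246 \<le> f" "f \<le> 32815659850012 * 2 ^ 246" "f > 0"
    by (simp_all add: f_def profile_count_3 by_size_def)
  have "1465 * ln 2 + ln 1.02483128571 \<le> 5 * ln f + ln A"
    "5 * ln f + ln B \<le> 1465 * ln 2 + ln 1.02483128572"
    unfolding A_def B_def by (rule log_growth_lower log_growth_upper; rule f)+
  with ln_2_bounds ln_lower ln_upper L(2,3) have "0.671617161058 \<le> 5 / 7 * L" "5 / 7 * L < 0.671617161059"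
    by (simp_all add: field_simps)
  then show ?thesis
    using N_DM_growth[OF L(1)] by blast
qed

end
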